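(* Let $V$ be a quasi-vertex operator algebra, $\Gamma\subset\mathrm{PSL}_2(\mathbb R)$ a Fuchsian group of the first kind, and let $\gamma_i\in\Gamma$ generate the stabilizer, of order $m_i$, of an elliptic point $\tau_i\in\mathbb H$ of $\Gamma$. Then $K(\gamma_i,\tau_i)^{m_i}=\mathrm{Id}_{F_NV}$ for every $N$. Consequently, for every weight $k$, the operator $j(\gamma_i,\tau_i)^kK(\gamma_i,\tau_i)$ restricted to $F_NV$ is of finite order, and hence is diagonalizable over $\mathbb C$.
   Context: QVOA: a quasi-vertex operator algebra is a $\mathbb Z$-graded vertex algebra $V=\bigoplus_n V_n$ over $\mathbb C$ (vertex operators $Y$, vacuum $\mathbf 1$) with $\dim V_n<\infty$ and $V_n=0$ for $n\ll0$, together with operators $L(-1),L(0),L(1)$ satisfying $[L(m),L(n)]=(m-n)L(m+n)$, where $L(-1)$ is the canonical derivation, $L(0)$ acts on $V_n$ as $n$ and $[L(1),Y(u,z)]=Y((L(1)+2zL(0)+z^2L(-1))u,z)$. $F_NV=\bigoplus_{n\le N}V_n$. Elements of $\Gamma$ are lifted to $\mathrm{SL}_2(\mathbb R)$. For $\gamma=\begin{pmatrix}a&b\\c&d\end{pmatrix}$: $j(\gamma,\tau)=c\tau+d$ and $K(\gamma,\tau)=e^{-c\,j(\gamma,\tau)L(1)}j(\gamma,\tau)^{-2L(0)}\in\mathrm{End}(V)$, which preserves every $F_NV$. The order $m_i$ is that of the (finite cyclic) stabilizer of $\tau_i$ in $\Gamma\subset\mathrm{PSL}_2(\mathbb R)$;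 the weight $k$ is an integer. *)

theory Defs
  imports
    "HOL-Analysis.Analysis"
    "HOL-Algebra.Generated_Groups"
    "HOL-Algebra.Group_Action"
    "HOL-Library.Groups_Big_Fun"
begin

section \<open>Quasi-vertex operator algebras\<close>

text \<open>
  The underlying complex vector space is the whole type \<open>'v\<close>.  The vertex operators are given by
  their modes: \<open>Y(u,z) = \<Sum>\<^sub>n (Y u n) z^(-n-1)\<close>, the sum being over all integers \<open>n\<close>.
  All sums over infinite index sets below have finite support, so that \<^const>\<open>Sum_any\<close> is their
  value; in the Borcherds (Jacobi) identity this is guaranteed by truncation.
\<close>

locale vertex_algebra = vector_space scale
  for scale :: "complex \<Rightarrow> 'v::ab_group_add \<Rightarrow> 'v" +
  fixes Y :: "'v \<Rightarrow> int \<Rightarrow> 'v \<Rightarrow> 'v"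
    and vac :: 'v
  assumes linear_state: "Vector_Spaces.linear scale scale (\<lambda>u. Y u n v)"
    and linear_mode: "Vector_Spaces.linear scale scale (Y u n)"
    and truncation: "\<exists>n0. \<forall>n\<ge>n0. Y u n v = 0"
    and vacuum: "Y vac n v = (if n = -1 then v else 0)"
    and creation: "Y u (-1) vac = u" "n \<ge> 0 \<Longrightarrow> Y u n vac = 0"
    and borcherds:
      "Sum_any (\<lambda>i. scale (of_int p gchoose i) (Y (Y u (r + int i) v) (p + q - int i) w))
       = Sum_any (\<lambda>i. scale ((-1) ^ i * (of_int r gchoose i))
           (Y u (p + r - int i) (Y v (q + int i) w)
            - scale ((-1) powi r) (Y v (q + r - int i) (Y u (p + int i) w))))"
begin

definition derivation :: "'v \<Rightarrow> 'v" where
  "derivation u = Y u (-2) vac"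

end

definition decomposition :: "(int \<Rightarrow> 'v::ab_group_add set) \<Rightarrow> 'v \<Rightarrow> (int \<Rightarrow> 'v) \<Rightarrow> bool" where
  "decomposition V v f \<longleftrightarrow> (\<forall>n. f n \<in> V n) \<and> finite {n. f n \<noteq> 0} \<and> v = Sum_any f"

locale graded_vertex_algebra = vertex_algebra scale Y vac
  for scale :: "complex \<Rightarrow> 'v::ab_group_add \<Rightarrow> 'v" and Y and vac +
  fixes V :: "int \<Rightarrow> 'v set"
  assumes subspace_V: "subspace (V n)"
    and direct_sum: "\<exists>!f. decomposition V v f"
    and vac_degree: "vac \<in> V 0"
    and mode_degree: "u \<in> V k \<Longrightarrow> v \<in> V l \<Longrightarrow> Y u n v \<in> V (k + l - n - 1)"
begin

definition component :: "'v \<Rightarrow> int \<Rightarrow> 'v" where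
  "component v = (THE f. decomposition V v f)"

definition F :: "int \<Rightarrow> 'v set" where
  "F N = span (\<Union>n\<in>{..N}. V n)"

end

text \<open>
  Only \<open>L (-1)\<close>, \<open>L 0\<close> and \<open>L 1\<close> are meaningful.  In the bracket relation the index \<open>m + n\<close> leaves
  \<open>{-1, 0, 1}\<close> only for \<open>m = n\<close>, where the coefficient vanishes.  The last axiom is the coefficient
  of \<open>z^(-n-1)\<close> in \<open>[L(1), Y(u,z)] = Y((L(1) + 2 z L(0) + z^2 L(-1)) u, z)\<close>.
\<close>

locale quasi_voa = graded_vertex_algebra scale Y vac V
  for scale :: "complex \<Rightarrow> 'v::ab_group_add \<Rightarrow> 'v" and Y and vac and V +
  fixes L :: "int \<Rightarrow> 'v \<Rightarrow> 'v"
  assumes finite_dim: "\<exists>B. finite B \<and> span B = V n"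
    and bounded_below: "\<exists>n0. \<forall>n<n0. V n = {0}"
    and linear_L: "m \<in> {-1, 0, 1} \<Longrightarrow> Vector_Spaces.linear scale scale (L m)"
    and bracket: "m \<in> {-1, 0, 1} \<Longrightarrow> n \<in> {-1, 0, 1} \<Longrightarrow>
      L m (L n v) - L n (L m v) = scale (of_int (m - n)) (L (m + n) v)"
    and L_minus1: "L (-1) u = derivation u"
    and L_0: "v \<in> V n \<Longrightarrow> L 0 v = scale (of_int n) v"
    and L_1: "L 1 (Y u n v) - Y u n (L 1 v)
      = Y (L 1 u) n v + scale 2 (Y (L 0 u) (n + 1) v) + Y (L (-1) u) (n + 2) v"

section \<open>Fuchsian groups\<close>

text \<open>HOL-Algebra quotients consist of cosets, so an element of \<open>PSL2R\<close> is the set of its two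
  lifts to \<open>SL2R\<close>.\<close>

definition SL2R :: "(real^2^2) monoid" where
  "SL2R = \<lparr>carrier = {A. det A = 1}, monoid.mult = (**), one = mat 1\<rparr>"

definition PSL2R :: "(real^2^2) set monoid" where
  "PSL2R = SL2R Mod {mat 1, - mat 1}"

definition PSL2R_topology :: "(real^2^2) set topology" where
  "PSL2R_topology = topology (\<lambda>U. U \<subseteq> carrier PSL2R \<and>
     openin (top_of_set (carrier SL2R)) {A \<in> carrier SL2R. {mat 1, - mat 1} #>\<^bsub>SL2R\<^esub> A \<in> U})"

definition upper_half_plane :: "complex set" where
  "upper_half_plane = {\<tau>. Im \<tau> > 0}"

definition j :: "real^2^2 \<Rightarrow> complex \<Rightarrow> complex" where
  "j g \<tau> = of_real (g$2$1) * \<tau> + of_real (g$2$2)"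

definition moebius :: "real^2^2 \<Rightarrow> complex \<Rightarrow> complex" where
  "moebius g \<tau> = (of_real (g$1$1) * \<tau> + of_real (g$1$2)) / j g \<tau>"

text \<open>Both lifts of an element of \<open>PSL2R\<close> act in the same way, so the image below is a singleton.\<close>

definition psl_act :: "(real^2^2) set \<Rightarrow> complex \<Rightarrow> complex" where
  "psl_act \<gamma> \<tau> = the_elem ((\<lambda>g. moebius g \<tau>) ` \<gamma>)"

definition fuchsian_group :: "(real^2^2) set set \<Rightarrow> bool" where
  "fuchsian_group \<Gamma> \<longleftrightarrow>
     subgroup \<Gamma> PSL2R \<and> subtopology PSL2R_topology \<Gamma> = discrete_topology \<Gamma>"

text \<open>The limit set consists of the accumulation points of orbits of points of the upper half-plane
  in the Riemann sphere, modelled as the one-point compactification of the plane (with \<open>None\<close> the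
  point at infinity).  Of the first kind means that the limit set is the whole boundary of the
  upper half-plane; finite covolume implies this and is not required.\<close>

definition limit_set :: "(real^2^2) set set \<Rightarrow> complex option set" where
  "limit_set \<Gamma> = (\<Union>z\<in>upper_half_plane. Alexandroff_compactification euclidean derived_set_of
     (Some ` orbit (PSL2R\<lparr>carrier := \<Gamma>\<rparr>) psl_act z))"

definition fuchsian_first_kind :: "(real^2^2) set set \<Rightarrow> bool" where
  "fuchsian_first_kind \<Gamma> \<longleftrightarrow>
     fuchsian_group \<Gamma> \<and> limit_set \<Gamma> = insert None (Some ` range complex_of_real)"

definition stab :: "(real^2^2) set set \<Rightarrow> complex \<Rightarrow> (real^2^2) set set" where
  "stab \<Gamma> \<tau> = stabilizer (PSL2R\<lparr>carrier := \<Gamma>\<rparr>) psl_act \<tau>"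

definition elliptic_point :: "(real^2^2) set set \<Rightarrow> complex \<Rightarrow> bool" where
  "elliptic_point \<Gamma> \<tau> \<longleftrightarrow> \<tau> \<in> upper_half_plane \<and> stab \<Gamma> \<tau> \<noteq> {\<one>\<^bsub>PSL2R\<^esub>}"

section \<open>The automorphy factor and operators on subspaces\<close>

context quasi_voa
begin

text \<open>\<open>exp_L1 x = e^(x L(1))\<close>, the sum being finite on each vector because \<open>L(1)\<close> lowers degrees,
  and \<open>pow_L0 x s = x^(s L(0))\<close>, which acts on \<open>V n\<close> as \<open>x^(s n)\<close>.\<close>

definition exp_L1 :: "complex \<Rightarrow> 'v \<Rightarrow> 'v" where
  "exp_L1 x v = Sum_any (\<lambda>k. scale (x ^ k / fact k) ((L 1 ^^ k) v))"

definition pow_L0 :: "complex \<Rightarrow> int \<Rightarrow> 'v \<Rightarrow> 'v" where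
  "pow_L0 x s v = Sum_any (\<lambda>n. scale (x powi (s * n)) (component v n))"

definition K :: "real^2^2 \<Rightarrow> complex \<Rightarrow> 'v \<Rightarrow> 'v" where
  "K g \<tau> = exp_L1 (- (of_real (g$2$1) * j g \<tau>)) \<circ> pow_L0 (j g \<tau>) (-2)"

end

definition operator_on ::
  "(complex \<Rightarrow> 'v::ab_group_add \<Rightarrow> 'v) \<Rightarrow> 'v set \<Rightarrow> ('v \<Rightarrow> 'v) \<Rightarrow> bool" where
  "operator_on smul W T \<longleftrightarrow> Vector_Spaces.linear smul smul T \<and> T ` W \<subseteq> W"

definition finite_order_on ::
  "(complex \<Rightarrow> 'v::ab_group_add \<Rightarrow> 'v) \<Rightarrow> 'v set \<Rightarrow> ('v \<Rightarrow> 'v) \<Rightarrow> bool" where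
  "finite_order_on smul W T \<longleftrightarrow>
     operator_on smul W T \<and> (\<exists>n>0. \<forall>v\<in>W. (T ^^ n) v = v)"

definition diagonalizable_on ::
  "(complex \<Rightarrow> 'v::ab_group_add \<Rightarrow> 'v) \<Rightarrow> 'v set \<Rightarrow> ('v \<Rightarrow> 'v) \<Rightarrow> bool" where
  "diagonalizable_on smul W T \<longleftrightarrow> operator_on smul W T \<and>
     (\<exists>B. \<not> module.dependent smul B \<and> module.span smul B = W
        \<and> (\<forall>b\<in>B. \<exists>c. T b = smul c b))"

section \<open>Well-definedness\<close>

lemma det_uminus_2: "det (- A) = det (A :: real^2^2)"
  by (simp add: det_2)

lemma group_SL2R: "group SL2R"
proof (rule groupI)
  fix A assume A: "A \<in> carrier SL2R"
  then have "invertible A"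
    by (simp add: SL2R_def invertible_det_nz)
  then obtain B where B: "B ** A = mat 1"
    unfolding invertible_def by blast
  then have "det B * det A = 1"
    by (metis det_I det_mul)
  with A B show "\<exists>B\<in>carrier SL2R. B \<otimes>\<^bsub>SL2R\<^esub> A = \<one>\<^bsub>SL2R\<^esub>"
    by (auto simp: SL2R_def)
qed (auto simp: SL2R_def det_mul matrix_mul_assoc)

lemma matrix_mul_uminus: "(- mat 1) ** A = - A" "A ** (- mat 1) = - (A :: real^2^2)"
  by (simp_all add: vec_eq_iff matrix_matrix_mult_def mat_def sum_2 forall_2)

lemma inv_SL2R_uminus: "inv\<^bsub>SL2R\<^esub> (- mat 1) = - mat 1"
  by (rule group.inv_equality[OF group_SL2R])
     (auto simp: SL2R_def matrix_mul_uminus det_uminus_2)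

lemma normal_pm1: "{mat 1, - mat 1} \<lhd> SL2R"
proof -
  interpret group SL2R by (rule group_SL2R)
  have "subgroup {mat 1, - mat 1} SL2R"
  proof (rule subgroupI)
    fix A assume "A \<in> {mat 1, - mat 1 :: real^2^2}"
    then show "inv\<^bsub>SL2R\<^esub> A \<in> {mat 1, - mat 1}"
      using inv_SL2R_uminus inv_one by (auto simp: SL2R_def)
  qed (auto simp: SL2R_def matrix_mul_uminus det_uminus_2)
  then show ?thesis
    by (rule normalI) (auto simp: SL2R_def r_coset_def l_coset_def matrix_mul_uminus)
qed

lemma group_PSL2R: "group PSL2R"
  unfolding PSL2R_def by (rule normal.factorgroup_is_group[OF normal_pm1])

lemma carrier_PSL2R: "carrier PSL2R = (\<lambda>A. {A, - A}) ` carrier SL2R"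
  by (auto simp: PSL2R_def carrier_FactGroup SL2R_def r_coset_def matrix_mul_uminus)

lemma psl_act_eq:
  assumes "\<gamma> \<in> carrier PSL2R" "g \<in> \<gamma>"
  shows "psl_act \<gamma> \<tau> = moebius g \<tau>"
proof -
  have "moebius (- A) \<tau> = moebius A \<tau>" for A
  proof -
    have "moebius (- A) \<tau>
        = (- (of_real (A$1$1) * \<tau> + of_real (A$1$2))) / (- j A \<tau>)"
      by (simp add: moebius_def j_def)
    then show ?thesis
      unfolding minus_divide_divide by (simp add: moebius_def)
  qed
  with assms have "(\<lambda>g. moebius g \<tau>) ` \<gamma> = {moebius g \<tau>}"
    by (force simp: carrier_PSL2R)
  then show ?thesis
    by (simp add: psl_act_def)
qed

lemma openin_PSL2R_topology:
  "openin PSL2R_topology U \<longleftrightarrow> U \<subseteq> carrier PSL2R \<and>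
     openin (top_of_set (carrier SL2R)) {A \<in> carrier SL2R. {mat 1, - mat 1} #>\<^bsub>SL2R\<^esub> A \<in> U}"
proof -
  let ?P = "\<lambda>U. {A \<in> carrier SL2R. {mat 1, - mat 1} #>\<^bsub>SL2R\<^esub> A \<in> U}"
  have int: "?P (S \<inter> T) = ?P S \<inter> ?P T" for S T by blast
  have un: "?P (\<Union>\<K>) = (\<Union>S\<in>\<K>. ?P S)" for \<K> by blast
  have "istopology (\<lambda>U. U \<subseteq> carrier PSL2R \<and> openin (top_of_set (carrier SL2R)) (?P U))"
    unfolding istopology_def int un by (intro conjI allI impI openin_Int openin_Union) auto
  then show ?thesis
    by (simp add: PSL2R_topology_def)
qed

end

theory Submission
  imports Defs "HOL-Algebra.Multiplicative_Group"
begin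

text \<open>
  Conjugating by an exponential of \<open>L 1\<close> makes \<open>K g \<tau>\<close> diagonal.  Put \<open>w = j g \<tau>\<close>,
  \<open>c = g$2$1\<close> and \<open>y = Im \<tau>\<close>.  Since \<open>L 1\<close> lowers degrees by one,
  \<open>w^(-2 L 0) e^(s L 1) = e^(s w^2 L 1) w^(-2 L 0)\<close> (\<open>pow_L0_exp_L1\<close>), so
  \<open>K g \<tau> e^(-t L 1) = e^((- c w - t w^2) L 1) w^(-2 L 0)\<close>.  If \<open>g\<close> fixes \<open>\<tau>\<close>, then \<open>w\<close> is
  an eigenvalue of \<open>g\<close> with \<open>|w| = 1\<close> and \<open>Im w = c y\<close>, and the exponent equals \<open>- t\<close> for
  \<open>t = \<i> / (2 y)\<close>.  Hence \<open>e^(t L 1) K g \<tau> e^(-t L 1) = w^(-2 L 0)\<close> (\<open>K_conjugate\<close>).  Geometrically,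
  a change of coordinate that takes \<open>\<tau>\<close> to the centre of the unit disc turns \<open>g\<close> into a rotation.

  The operator on the right acts on \<open>V n\<close> as \<open>w^(-2n)\<close>.  Therefore \<open>e^(-t L 1)\<close> takes a basis of
  \<open>F N\<close> made of homogeneous vectors to a basis of eigenvectors of \<open>K g \<tau>\<close>, and \<open>K g \<tau>\<close> has
  \<open>m\<close>-th power \<open>1\<close> as soon as \<open>w^(2m) = 1\<close>.  The latter holds because \<open>g^m\<close> lifts the identity of
  \<open>PSL2R\<close>, so that \<open>g^m\<close> is plus or minus the identity matrix and \<open>w^m\<close> is \<open>1\<close> or \<open>-1\<close>.
  A scalar factor \<open>w^k\<close> keeps the eigenvectors and is a root of unity too.

  Finite order is only a statement about \<open>K\<close> if \<open>m > 0\<close>, that is, if the stabilizer is finite: this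
  is where discreteness enters.  A matrix of determinant one fixing \<open>\<tau>\<close> is a continuous function of
  its eigenvalue (\<open>fixing_matrix\<close>), and the powers of \<open>w\<close> return arbitrarily close to \<open>1\<close> by
  compactness of the circle.  So some positive power of \<open>g\<close> comes so close to the identity that its
  class in \<open>\<Gamma>\<close> must be trivial (\<open>elliptic_power_eq_one\<close>).
\<close>

section \<open>Lifts of elliptic elements\<close>

lemma SL2R_record_simps [simp]:
  "A \<in> carrier SL2R \<longleftrightarrow> det A = 1" "A \<otimes>\<^bsub>SL2R\<^esub> B = A ** B" "\<one>\<^bsub>SL2R\<^esub> = mat 1"
  by (simp_all add: SL2R_def)

text \<open>Written without a denominator, being fixed says that \<open>(\<tau>, 1)\<close> is an eigenvector of the matrix
  for the eigenvalue \<open>j A \<tau>\<close>; in this form \<open>j\<close> is visibly multiplicative on the matrices fixing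
  \<open>\<tau>\<close>.\<close>

definition fixes_point :: "real^2^2 \<Rightarrow> complex \<Rightarrow> bool" where
  "fixes_point A \<tau> \<longleftrightarrow> of_real (A$1$1) * \<tau> + of_real (A$1$2) = j A \<tau> * \<tau>"

lemma fixes_point_if_moebius:
  assumes "moebius A \<tau> = \<tau>" "\<tau> \<in> upper_half_plane"
  shows "fixes_point A \<tau>"
proof -
  \<comment> \<open>If \<open>j A \<tau>\<close> were zero, the quotient defining \<open>moebius\<close> would be \<open>0\<close>, which is not in the half-plane.\<close>
  have "j A \<tau> \<noteq> 0"
    using assms by (auto simp: moebius_def upper_half_plane_def)
  with assms(1) show ?thesis
    by (simp add: moebius_def fixes_point_def field_simps)
qed

lemma fixes_point_mult:
  assumes "fixes_point A \<tau>" "fixes_point B \<tau>"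
  shows "fixes_point (A ** B) \<tau>" "j (A ** B) \<tau> = j A \<tau> * j B \<tau>"
proof -
  let ?row = "\<lambda>i. of_real (A$i$1) * (of_real (B$1$1) * \<tau> + of_real (B$1$2))
                + of_real (A$i$2) * j B \<tau>"
  have row: "of_real ((A ** B)$i$1) * \<tau> + of_real ((A ** B)$i$2) = ?row i" for i
    by (simp add: matrix_matrix_mult_def sum_2 j_def algebra_simps)
  have row': "?row i = (of_real (A$i$1) * \<tau> + of_real (A$i$2)) * j B \<tau>" for i
    using assms(2) by (simp add: fixes_point_def algebra_simps)
  show j: "j (A ** B) \<tau> = j A \<tau> * j B \<tau>"
    using row[of 2] row'[of 2] by (simp add: j_def[of "A ** B"] j_def[of A])
  show "fixes_point (A ** B) \<tau>"
    using row[of 1] row'[of 1] assms(1) unfolding fixes_point_def j by simp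
qed

lemma fixes_point_power:
  fixes n :: nat
  assumes "fixes_point A \<tau>"
  shows "fixes_point (A [^]\<^bsub>SL2R\<^esub> n) \<tau> \<and> j (A [^]\<^bsub>SL2R\<^esub> n) \<tau> = j A \<tau> ^ n"
proof (induction n)
  case 0
  show ?case by (simp add: fixes_point_def j_def mat_def)
next
  case (Suc n)
  with fixes_point_mult[OF _ assms] show ?case by simp
qed

text \<open>The real matrix with eigenvector \<open>(\<tau>, 1)\<close> for the eigenvalue \<open>w\<close>, hence with
  \<open>(cnj \<tau>, 1)\<close> for \<open>cnj w\<close>; its lower row is read off from \<open>w = c \<tau> + d\<close>.\<close>

definition fixing_matrix :: "complex \<Rightarrow> complex \<Rightarrow> real^2^2" where
  "fixing_matrix \<tau> w = vector
     [vector [Re w + Re \<tau> * (Im w / Im \<tau>), - (Im w / Im \<tau>) * (cmod \<tau>)\<^sup>2],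
      vector [Im w / Im \<tau>, Re w - Re \<tau> * (Im w / Im \<tau>)]]"

lemma fixing_matrix_j:
  assumes "fixes_point A \<tau>" "\<tau> \<in> upper_half_plane"
  shows "fixing_matrix \<tau> (j A \<tau>) = A"
proof -
  have y: "Im \<tau> > 0" using assms(2) by (simp add: upper_half_plane_def)
  have c: "Im (j A \<tau>) / Im \<tau> = A$2$1" and d: "Re (j A \<tau>) = A$2$1 * Re \<tau> + A$2$2"
    using y by (simp_all add: j_def)
  from assms(1) have im: "A$1$1 * Im \<tau> = Re (j A \<tau>) * Im \<tau> + Im (j A \<tau>) * Re \<tau>"
    and re: "A$1$1 * Re \<tau> + A$1$2 = Re (j A \<tau>) * Re \<tau> - Im (j A \<tau>) * Im \<tau>"
    unfolding fixes_point_def by (simp_all add: complex_eq_iff)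
  have a: "A$1$1 = Re (j A \<tau>) + Re \<tau> * A$2$1"
    using im y unfolding c[symmetric] by (simp add: field_simps)
  have Im_j: "Im (j A \<tau>) = A$2$1 * Im \<tau>"
    by (simp add: j_def)
  have b: "A$1$2 = - A$2$1 * (cmod \<tau>)\<^sup>2"
    using re unfolding a Im_j cmod_power2 by (simp add: power2_eq_square algebra_simps)
  show ?thesis
    using a b d by (simp add: fixing_matrix_def c vec_eq_iff forall_2)
qed

lemma continuous_fixing_matrix: "continuous_on UNIV (fixing_matrix \<tau>)"
proof -
  have "continuous_on UNIV (\<lambda>w. fixing_matrix \<tau> w $ i $ k)" for i k
    using exhaust_2[of i] exhaust_2[of k]
    by (elim disjE; simp add: fixing_matrix_def divide_inverse; intro continuous_intros)
  then have "continuous_on UNIV (\<lambda>w. \<chi> i k. fixing_matrix \<tau> w $ i $ k)"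
    by (intro continuous_on_vec_lambda)
  then show ?thesis by simp
qed

text \<open>The determinant of \<open>fixing_matrix \<tau> w\<close> is the product \<open>w * cnj w\<close> of the two eigenvalues.\<close>

lemma norm_j_eq_1:
  assumes "fixes_point A \<tau>" "\<tau> \<in> upper_half_plane" "det A = 1"
  shows "cmod (j A \<tau>) = 1"
proof -
  define w where "w = j A \<tau>"
  define t where "t = Im w / Im \<tau>"
  have y: "Im \<tau> > 0" using assms(2) by (simp add: upper_half_plane_def)
  have t: "Im w = t * Im \<tau>" using y by (simp add: t_def)
  have "det (fixing_matrix \<tau> w) = 1"
    using assms fixing_matrix_j by (simp add: w_def)
  then have "(Re w)\<^sup>2 + (Im w)\<^sup>2 = 1"
    unfolding det_2 fixing_matrix_def t_def[symmetric] cmod_power2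
    by (simp add: t power2_eq_square algebra_simps)
  then show ?thesis by (simp add: w_def cmod_def)
qed

section \<open>Discreteness\<close>

text \<open>A convergent subsequence of the powers of \<open>w\<close> has consecutive quotients tending to \<open>1\<close>, and these
  quotients are themselves positive powers of \<open>w\<close>.  This covers roots of unity and irrational
  rotations alike.\<close>

lemma unit_circle_recurrent:
  assumes "cmod w = 1" "open S" "1 \<in> S"
  shows "\<exists>n>0. w ^ n \<in> S"
proof -
  have "w ^ n \<in> sphere 0 1" for n
    using assms(1) by (simp add: norm_power)
  then obtain l r where l: "l \<in> sphere 0 1" and r: "strict_mono r"
    and lim: "((\<lambda>n. w ^ n) \<circ> r) \<longlonglongrightarrow> l"
    using compact_sphere[of "0::complex" 1] unfolding compact_eq_seq_compact_metric seq_compact_def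
    by metis
  have l0: "l \<noteq> 0" using l by auto
  have w0: "w \<noteq> 0" using assms(1) by auto
  have "(\<lambda>n. w ^ r (Suc n) / w ^ r n) \<longlonglongrightarrow> l / l"
    using lim by (intro tendsto_divide l0 LIMSEQ_Suc) (simp_all add: o_def)
  then have "\<forall>\<^sub>F n in sequentially. w ^ r (Suc n) / w ^ r n \<in> S"
    using assms(2,3) l0 by (intro topological_tendstoD) auto
  then obtain n where n: "w ^ r (Suc n) / w ^ r n \<in> S"
    using eventually_happens' sequentially_bot by blast
  have less: "r n < r (Suc n)" using r by (simp add: strict_mono_def)
  then have "w ^ (r (Suc n) - r n) \<in> S"
    using n w0 by (simp add: power_diff)
  with less show ?thesis
    by (intro exI[of _ "r (Suc n) - r n"]) simp
qed

lemma PSL2R_pow: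
  fixes n :: nat
  assumes "g \<in> carrier SL2R"
  shows "({mat 1, - mat 1} #>\<^bsub>SL2R\<^esub> g) [^]\<^bsub>PSL2R\<^esub> n = {mat 1, - mat 1} #>\<^bsub>SL2R\<^esub> (g [^]\<^bsub>SL2R\<^esub> n)"
proof -
  have "group_hom SL2R PSL2R (\<lambda>a. {mat 1, - mat 1} #>\<^bsub>SL2R\<^esub> a)"
    using normal.r_coset_hom_Mod[OF normal_pm1] group_SL2R group_PSL2R
    by (simp add: group_hom_def group_hom_axioms_def PSL2R_def)
  then show ?thesis
    using group_hom.hom_nat_pow assms by fastforce
qed

lemma PSL2R_eq_coset:
  assumes "\<gamma> \<in> carrier PSL2R" "g \<in> \<gamma>"
  shows "g \<in> carrier SL2R" "\<gamma> = {mat 1, - mat 1} #>\<^bsub>SL2R\<^esub> g"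
  using assms by (auto simp: carrier_PSL2R r_coset_def matrix_mul_uminus det_uminus_2)

lemma one_PSL2R: "\<one>\<^bsub>PSL2R\<^esub> = {mat 1, - mat 1}"
  by (simp add: PSL2R_def FactGroup_def)

text \<open>Recurrence of the eigenvalue becomes recurrence of \<open>g\<close> through \<open>fixing_matrix\<close>; an element of a
  discrete group sufficiently near the identity is the identity.\<close>

lemma elliptic_power_eq_one:
  assumes fuchs: "fuchsian_group \<Gamma>" and \<gamma>: "\<gamma> \<in> \<Gamma>" and g: "g \<in> \<gamma>"
    and fp: "fixes_point g \<tau>" and \<tau>: "\<tau> \<in> upper_half_plane"
  shows "\<exists>n>0. \<gamma> [^]\<^bsub>PSL2R\<^esub> (n::nat) = \<one>\<^bsub>PSL2R\<^esub>"
proof -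
  let ?H = "{mat 1, - mat 1 :: real^2^2}"
  interpret P: group PSL2R by (rule group_PSL2R)
  have sub: "subgroup \<Gamma> PSL2R"
    and disc: "subtopology PSL2R_topology \<Gamma> = discrete_topology \<Gamma>"
    using fuchs by (auto simp: fuchsian_group_def)
  have \<gamma>P: "\<gamma> \<in> carrier PSL2R"
    using sub \<gamma> by (rule subgroup.mem_carrier)
  note coset = PSL2R_eq_coset[OF \<gamma>P g]
  have "openin (subtopology PSL2R_topology \<Gamma>) {\<one>\<^bsub>PSL2R\<^esub>}"
    using sub by (simp add: disc subgroup.one_closed)
  then obtain U where U: "openin PSL2R_topology U" "{\<one>\<^bsub>PSL2R\<^esub>} = U \<inter> \<Gamma>"
    by (auto simp: openin_subtopology)
  \<comment> \<open>Openness in \<open>PSL2R\<close> is pulled back to matrices, where recurrence can be applied.\<close>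
  then obtain T where T: "open T"
    "{A \<in> carrier SL2R. ?H #>\<^bsub>SL2R\<^esub> A \<in> U} = carrier SL2R \<inter> T"
    by (auto simp: openin_PSL2R_topology openin_open)
  have "?H #>\<^bsub>SL2R\<^esub> mat 1 = \<one>\<^bsub>PSL2R\<^esub>"
    by (auto simp: one_PSL2R r_coset_def matrix_mul_uminus)
  then have "mat 1 \<in> {A \<in> carrier SL2R. ?H #>\<^bsub>SL2R\<^esub> A \<in> U}"
    using U(2) by auto
  then have "mat 1 \<in> T" unfolding T(2) by simp
  moreover have "fixing_matrix \<tau> 1 = mat 1"
    using fixing_matrix_j[of "mat 1" \<tau>] \<tau> by (simp add: fixes_point_def j_def mat_def)
  ultimately have "1 \<in> fixing_matrix \<tau> -` T" by simp
  moreover have "open (fixing_matrix \<tau> -` T)"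
    using continuous_fixing_matrix T(1) by (rule open_vimage[rotated])
  moreover have "cmod (j g \<tau>) = 1"
    using norm_j_eq_1 fp \<tau> coset(1) by simp
  ultimately obtain n where n: "n > 0" "fixing_matrix \<tau> (j g \<tau> ^ n) \<in> T"
    using unit_circle_recurrent by blast
  have "fixing_matrix \<tau> (j g \<tau> ^ n) = g [^]\<^bsub>SL2R\<^esub> n"
    using fixing_matrix_j \<tau> fixes_point_power[OF fp, of n] by metis
  with n have "g [^]\<^bsub>SL2R\<^esub> n \<in> carrier SL2R \<inter> T"
    using monoid.nat_pow_closed[OF group.is_monoid[OF group_SL2R] coset(1)] by simp
  then have "?H #>\<^bsub>SL2R\<^esub> (g [^]\<^bsub>SL2R\<^esub> n) \<in> U"
    unfolding T(2)[symmetric] by simp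
  then have "\<gamma> [^]\<^bsub>PSL2R\<^esub> n \<in> U"
    using PSL2R_pow[OF coset(1), of n] coset(2) by simp
  moreover have "\<gamma> [^]\<^bsub>PSL2R\<^esub> n \<in> \<Gamma>"
    using sub \<gamma> by (induction n) (auto simp: subgroup.one_closed subgroup.m_closed)
  ultimately show ?thesis using U(2) n(1) by blast
qed

text \<open>Both \<open>card\<close> and \<open>ord\<close> are \<open>0\<close> in the infinite case, so positivity of \<open>m\<close> is exactly
  finiteness of the group generated by \<open>\<gamma>\<close>.  The square in the second claim absorbs the sign of the
  lift.\<close>

lemma elliptic_order:
  assumes "fuchsian_group \<Gamma>" "\<gamma> \<in> \<Gamma>" "g \<in> \<gamma>" "fixes_point g \<tau>" "\<tau> \<in> upper_half_plane"
    and m: "m = card (generate PSL2R {\<gamma>})"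
  shows "m > 0" "(j g \<tau> ^ m)\<^sup>2 = 1"
proof -
  interpret P: group PSL2R by (rule group_PSL2R)
  have \<gamma>P: "\<gamma> \<in> carrier PSL2R"
    using assms(1,2) by (auto simp: fuchsian_group_def dest: subgroup.mem_carrier)
  have m: "m = P.ord \<gamma>"
    unfolding m by (rule P.generate_pow_card[OF \<gamma>P, symmetric])
  obtain n :: nat where "n > 0" "\<gamma> [^]\<^bsub>PSL2R\<^esub> n = \<one>\<^bsub>PSL2R\<^esub>"
    using elliptic_power_eq_one[OF assms(1-5)] by blast
  then show "m > 0"
    using P.pow_eq_id[OF \<gamma>P, of n] by (auto simp: m intro: Nat.gr0I)
  note coset = PSL2R_eq_coset[OF \<gamma>P assms(3)]
  have "{mat 1, - mat 1} #>\<^bsub>SL2R\<^esub> (g [^]\<^bsub>SL2R\<^esub> m) = {mat 1, - mat 1}"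
    using P.pow_ord_eq_1[OF \<gamma>P] PSL2R_pow[OF coset(1), of m] coset(2)
    by (simp add: one_PSL2R m)
  moreover have "g [^]\<^bsub>SL2R\<^esub> m \<in> {mat 1, - mat 1} #>\<^bsub>SL2R\<^esub> (g [^]\<^bsub>SL2R\<^esub> m)"
    by (auto simp: r_coset_def)
  ultimately have "g [^]\<^bsub>SL2R\<^esub> m \<in> {mat 1, - mat 1}" by simp
  then have "j (g [^]\<^bsub>SL2R\<^esub> m) \<tau> = 1 \<or> j (g [^]\<^bsub>SL2R\<^esub> m) \<tau> = -1"
    by (auto simp: j_def mat_def)
  then show "(j g \<tau> ^ m)\<^sup>2 = 1"
    using fixes_point_power[OF assms(4), of m] by auto
qed

section \<open>The operators on a quasi-vertex operator algebra\<close>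

text \<open>The coefficient form of \<open>e^(x+y) = e^x e^y\<close>.\<close>

lemma exp_coefficient_add:
  fixes x y :: complex
  shows "(x + y) ^ p / fact p = (\<Sum>i\<le>p. x ^ i / fact i * (y ^ (p - i) / fact (p - i)))"
proof -
  have "of_nat (p choose i) * x ^ i * y ^ (p - i) / fact p
      = x ^ i / fact i * (y ^ (p - i) / fact (p - i))" if "i \<le> p" for i
    using binomial_fact[OF that, where ?'a = complex] by (simp add: field_simps)
  then show ?thesis
    by (simp add: binomial_ring sum_divide_distrib)
qed

lemma power_int_power_commute: "(x powi k) ^ n = (x ^ n) powi k" for x :: complex
  by (simp only: power_int_of_nat[symmetric] power_int_mult[symmetric] mult.commute)

context quasi_voa
begin

interpretation vs: vector_space_pair scale scale
  by unfold_locales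

lemma linearI:
  assumes "\<And>u v. f (u + v) = f u + f v" "\<And>c v. f (scale c v) = scale c (f v)"
  shows "Vector_Spaces.linear scale scale f"
  using assms vector_space_axioms by (simp add: Vector_Spaces.linear_iff)

lemma linear_funpow:
  assumes "Vector_Spaces.linear scale scale f"
  shows "Vector_Spaces.linear scale scale (f ^^ n)"
proof (induction n)
  case 0
  show ?case by (rule linearI) simp_all
next
  case (Suc n)
  then show ?case
    unfolding funpow.simps using assms by (rule Vector_Spaces.linear_compose)
qed

subsection \<open>Homogeneous components\<close>

lemma decomposition_component: "decomposition V v (component v)"
  unfolding component_def using direct_sum by (rule theI')

lemma component_eqI: "decomposition V v f \<Longrightarrow> component v = f"
  using direct_sum decomposition_component by blast

lemma component_mem: "component v n \<in> V n"
  and finite_support: "finite {n. component v n \<noteq> 0}"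
  using decomposition_component by (auto simp: decomposition_def)

lemma sum_component:
  assumes "finite A" "{n. component v n \<noteq> 0} \<subseteq> A"
  shows "(\<Sum>n\<in>A. component v n) = v"
  using decomposition_component[of v] Sum_any.expand_superset[OF assms]
  by (simp add: decomposition_def)

lemma component_eq_sumI:
  assumes "\<And>n. f n \<in> V n" "finite A" "{n. f n \<noteq> 0} \<subseteq> A" "v = sum f A"
  shows "component v = f"
  using assms Sum_any.expand_superset[OF assms(2,3)]
  by (intro component_eqI) (auto simp: decomposition_def intro: finite_subset)

lemma component_homogeneous: "v \<in> V n \<Longrightarrow> component v = (\<lambda>i. if i = n then v else 0)"
  using subspace_V by (intro component_eq_sumI[of _ "{n}"]) (auto simp: subspace_0)

lemma component_add: "component (u + v) = (\<lambda>n. component u n + component v n)"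
proof (rule component_eq_sumI)
  let ?A = "{n. component u n \<noteq> 0} \<union> {n. component v n \<noteq> 0}"
  show "finite ?A" by (simp add: finite_support)
  show "u + v = (\<Sum>n\<in>?A. component u n + component v n)"
    unfolding sum.distrib by (subst (1 2) sum_component) (auto simp: finite_support)
qed (auto simp: component_mem intro: subspace_add subspace_V)

lemma component_scale: "component (scale c v) = (\<lambda>n. scale c (component v n))"
  by (rule component_eq_sumI[of _ "{n. component v n \<noteq> 0}"])
     (auto simp: component_mem finite_support sum_component simp flip: scale_sum_right
           intro: subspace_scale subspace_V)

lemma component_L0: "component (L 0 v) = (\<lambda>n. scale (of_int n) (component v n))"
proof (rule component_eq_sumI)
  let ?A = "{n. component v n \<noteq> 0}"
  have lin: "Vector_Spaces.linear scale scale (L 0)" by (rule linear_L) simp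
  have "L 0 v = L 0 (\<Sum>n\<in>?A. component v n)"
    by (simp add: sum_component finite_support)
  also have "\<dots> = (\<Sum>n\<in>?A. scale (of_int n) (component v n))"
    unfolding vs.linear_sum[OF lin] by (intro sum.cong refl L_0 component_mem)
  finally show "L 0 v = (\<Sum>n\<in>?A. scale (of_int n) (component v n))" .
qed (auto simp: component_mem finite_support intro: subspace_scale subspace_V)

text \<open>Comparing components, an eigenvector of \<open>L 0\<close> with eigenvalue \<open>n\<close> has no component outside
  degree \<open>n\<close>.  So degrees can be computed from commutators with \<open>L 0\<close>.\<close>

lemma L0_eigenspace:
  assumes "L 0 v = scale (of_int n) v"
  shows "v \<in> V n"
proof -
  have "scale (of_int i) (component v i) = scale (of_int n) (component v i)" for i
    using component_L0[of v] component_scale[of "of_int n" v] assms by metis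
  then have "{i. component v i \<noteq> 0} \<subseteq> {n}"
    by auto
  then have "v = component v n"
    using sum_component[of "{n}" v] by simp
  then show ?thesis using component_mem by metis
qed

lemma linear_eq_if_eq_homogeneous:
  assumes "Vector_Spaces.linear scale scale f" "Vector_Spaces.linear scale scale h"
    and "\<And>n v. v \<in> V n \<Longrightarrow> f v = h v"
  shows "f v = h v"
proof -
  have "f v = (\<Sum>n | component v n \<noteq> 0. f (component v n))"
    by (subst vs.linear_sum[OF assms(1), symmetric]) (simp add: sum_component finite_support)
  also have "\<dots> = (\<Sum>n | component v n \<noteq> 0. h (component v n))"
    by (intro sum.cong refl assms(3)[OF component_mem])
  also have "\<dots> = h v"
    by (subst vs.linear_sum[OF assms(2), symmetric]) (simp add: sum_component finite_support)
  finally show ?thesis .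
qed

subsection \<open>The lowering operator\<close>

lemma linear_L1: "Vector_Spaces.linear scale scale (L 1)"
  by (rule linear_L) simp

lemma L1_degree:
  assumes "v \<in> V n"
  shows "L 1 v \<in> V (n - 1)"
proof (rule L0_eigenspace)
  have "L 0 (L 1 v) - L 1 (L 0 v) = scale (-1) (L 1 v)"
    using bracket[of 0 1 v] by simp
  then have "L 0 (L 1 v) = scale (-1) (L 1 v) + scale (of_int n) (L 1 v)"
    by (simp add: L_0[OF assms] vs.linear_scale[OF linear_L1] diff_eq_eq)
  then show "L 0 (L 1 v) = scale (of_int (n - 1)) (L 1 v)"
    by (simp add: scale_left_diff_distrib)
qed

lemma L1_power_degree: "v \<in> V n \<Longrightarrow> (L 1 ^^ k) v \<in> V (n - int k)"
proof (induction k)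
  case (Suc k)
  then have "L 1 ((L 1 ^^ k) v) \<in> V (n - int k - 1)"
    using L1_degree by blast
  moreover have "n - int k - 1 = n - int (Suc k)" by simp
  ultimately show ?case by (metis comp_apply funpow.simps(2))
qed simp

lemma linear_L1_power: "Vector_Spaces.linear scale scale (L 1 ^^ k)"
  by (rule linear_funpow[OF linear_L1])

lemma L1_power_eq_0_mono:
  assumes "(L 1 ^^ n) v = 0" "n \<le> k"
  shows "(L 1 ^^ k) v = 0"
proof -
  have "(L 1 ^^ k) v = (L 1 ^^ (k - n)) ((L 1 ^^ n) v)"
    using assms(2) by (metis funpow_add le_add_diff_inverse2 o_apply)
  then show ?thesis by (simp add: assms(1) vs.linear_0[OF linear_L1_power])
qed

text \<open>Each application of \<open>L 1\<close> lowers all degrees, which are bounded below; the exponent depends only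
  on the top degree of the vector.\<close>

lemma L1_locally_nilpotent: "\<exists>n. (L 1 ^^ n) v = 0"
proof -
  obtain n0 where n0: "\<And>n. n < n0 \<Longrightarrow> V n = {0}"
    using bounded_below by blast
  have hom: "(L 1 ^^ nat (M - n0 + 1)) u = 0" if "u \<in> V n" "n \<le> M" for u n M
  proof (cases "n < n0")
    case True
    then show ?thesis using n0 that(1) by (auto simp: vs.linear_0[OF linear_L1_power])
  next
    case False
    then have "n - int (nat (M - n0 + 1)) < n0" using that(2) by simp
    then show ?thesis using L1_power_degree[OF that(1)] n0 by blast
  qed
  let ?A = "{n. component v n \<noteq> 0}"
  obtain M where M: "\<And>n. n \<in> ?A \<Longrightarrow> n \<le> M"
    using finite_support[of v] by (meson bdd_above_def bdd_above_finite)
  have "(L 1 ^^ nat (M - n0 + 1)) (\<Sum>n\<in>?A. component v n) = 0"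
    unfolding vs.linear_sum[OF linear_L1_power]
    by (intro sum.neutral ballI hom[OF component_mem] M)
  then show ?thesis by (auto simp: sum_component finite_support)
qed

subsection \<open>Exponentials of the lowering operator\<close>

text \<open>Any sufficiently large cut-off may be used, so that several vectors can share one.\<close>

lemma exp_L1_eq_sum:
  assumes "(L 1 ^^ n) v = 0"
  shows "exp_L1 x v = (\<Sum>k<n. scale (x ^ k / fact k) ((L 1 ^^ k) v))"
  unfolding exp_L1_def
proof (rule Sum_any.expand_superset)
  show "{k. scale (x ^ k / fact k) ((L 1 ^^ k) v) \<noteq> 0} \<subseteq> {..<n}"
    by (rule subsetI, rule ccontr) (simp add: not_less L1_power_eq_0_mono[OF assms])
qed simp

lemma exp_L1_0: "exp_L1 0 v = v"
proof -
  obtain n where n: "(L 1 ^^ n) v = 0" using L1_locally_nilpotent by blast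
  have "exp_L1 0 v = (\<Sum>k<Suc n. scale (0 ^ k / fact k) ((L 1 ^^ k) v))"
    by (intro exp_L1_eq_sum L1_power_eq_0_mono[OF n]) simp
  also have "\<dots> = (\<Sum>k<Suc n. if k = 0 then v else 0)"
    by (intro sum.cong refl) (simp add: power_0_left)
  also have "\<dots> = v" by (simp del: sum.lessThan_Suc)
  finally show ?thesis .
qed

lemma linear_exp_L1: "Vector_Spaces.linear scale scale (exp_L1 x)"
proof (rule linearI)
  fix u v
  obtain a b where ab: "(L 1 ^^ a) u = 0" "(L 1 ^^ b) v = 0"
    using L1_locally_nilpotent by metis
  have u: "(L 1 ^^ max a b) u = 0" and v: "(L 1 ^^ max a b) v = 0"
    using ab L1_power_eq_0_mono by simp_all
  then have uv: "(L 1 ^^ max a b) (u + v) = 0"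
    by (simp add: vs.linear_add[OF linear_L1_power])
  show "exp_L1 x (u + v) = exp_L1 x u + exp_L1 x v"
    by (simp only: exp_L1_eq_sum[OF u] exp_L1_eq_sum[OF v] exp_L1_eq_sum[OF uv]
        vs.linear_add[OF linear_L1_power] scale_right_distrib sum.distrib)
next
  fix c v
  obtain n where n: "(L 1 ^^ n) v = 0" using L1_locally_nilpotent by blast
  then have "(L 1 ^^ n) (scale c v) = 0"
    by (simp add: vs.linear_scale[OF linear_L1_power])
  then show "exp_L1 x (scale c v) = scale c (exp_L1 x v)"
    by (simp add: exp_L1_eq_sum[of n] n vs.linear_scale[OF linear_L1_power] scale_sum_right
        mult.commute)
qed

lemma exp_L1_add: "exp_L1 x (exp_L1 y v) = exp_L1 (x + y) v"
proof -
  obtain n where n: "(L 1 ^^ n) v = 0" using L1_locally_nilpotent by blast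
  let ?c = "\<lambda>z k. z ^ k / fact k :: complex"
  let ?h = "\<lambda>(k, l). scale (?c x k * ?c y l) ((L 1 ^^ (k + l)) v)"
  have pow: "(L 1 ^^ k) (exp_L1 y v) = (\<Sum>l<n. scale (?c y l) ((L 1 ^^ (k + l)) v))" for k
    by (simp add: exp_L1_eq_sum[OF n] vs.linear_sum[OF linear_L1_power]
        vs.linear_scale[OF linear_L1_power] funpow_add)
  have "(L 1 ^^ n) (exp_L1 y v) = 0"
    unfolding pow using L1_power_eq_0_mono[OF n] by (intro sum.neutral) simp
  then have "exp_L1 x (exp_L1 y v) = (\<Sum>k<n. scale (?c x k) ((L 1 ^^ k) (exp_L1 y v)))"
    by (rule exp_L1_eq_sum)
  also have "\<dots> = sum ?h ({..<n} \<times> {..<n})"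
    by (simp add: pow scale_sum_right sum.cartesian_product)
  \<comment> \<open>The square of indices may be cut down to the triangle: beyond it \<open>L 1\<close> kills \<open>v\<close>.\<close>
  also have "\<dots> = sum ?h {(k, l). k + l < n}"
  proof (rule sum.mono_neutral_right)
    show "\<forall>i\<in>{..<n} \<times> {..<n} - {(k, l). k + l < n}. ?h i = 0"
    proof
      fix i assume "i \<in> {..<n} \<times> {..<n} - {(k, l). k + l < n}"
      then have "n \<le> fst i + snd i" by (auto simp: not_less)
      then show "?h i = 0" by (simp add: split_beta L1_power_eq_0_mono[OF n])
    qed
  qed auto
  also have "\<dots> = (\<Sum>p<n. \<Sum>i\<le>p. scale (?c x i * ?c y (p - i)) ((L 1 ^^ p) v))"
    by (subst sum.triangle_reindex) simp
  also have "\<dots> = (\<Sum>p<n. scale (?c (x + y) p) ((L 1 ^^ p) v))"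
    by (simp only: exp_coefficient_add scale_sum_left)
  also have "\<dots> = exp_L1 (x + y) v"
    by (rule exp_L1_eq_sum[OF n, symmetric])
  finally show ?thesis .
qed

subsection \<open>The grading operator and the automorphy factor\<close>

lemma pow_L0_eq_sum:
  assumes "finite A" "{n. component v n \<noteq> 0} \<subseteq> A"
  shows "pow_L0 x s v = (\<Sum>n\<in>A. scale (x powi (s * n)) (component v n))"
  unfolding pow_L0_def using assms by (intro Sum_any.expand_superset) auto

lemma pow_L0_homogeneous: "v \<in> V n \<Longrightarrow> pow_L0 x s v = scale (x powi (s * n)) v"
  by (subst pow_L0_eq_sum[of "{n}"]) (auto simp: component_homogeneous)

lemma linear_pow_L0: "Vector_Spaces.linear scale scale (pow_L0 x s)"
proof (rule linearI)
  fix u v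
  let ?A = "{n. component u n \<noteq> 0} \<union> {n. component v n \<noteq> 0}"
  have "finite ?A" by (simp add: finite_support)
  then show "pow_L0 x s (u + v) = pow_L0 x s u + pow_L0 x s v"
    by (subst (1 2 3) pow_L0_eq_sum[of ?A])
       (auto simp: component_add scale_right_distrib sum.distrib)
next
  fix c v
  let ?A = "{n. component v n \<noteq> 0}"
  show "pow_L0 x s (scale c v) = scale c (pow_L0 x s v)"
    by (subst (1 2) pow_L0_eq_sum[of ?A])
       (auto simp: finite_support component_scale scale_sum_right mult.commute)
qed

text \<open>On \<open>V n\<close> the \<open>k\<close>-th term of the exponential has degree \<open>n - k\<close>, so \<open>x^(-2 L 0)\<close> multiplies it
  by an additional \<open>x^(2k)\<close>, which rescales the parameter by \<open>x^2\<close>.\<close>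

lemma pow_L0_exp_L1:
  assumes "x \<noteq> 0"
  shows "pow_L0 x (-2) (exp_L1 t v) = exp_L1 (t * x\<^sup>2) (pow_L0 x (-2) v)"
proof (rule linear_eq_if_eq_homogeneous[where f = "\<lambda>v. pow_L0 x (-2) (exp_L1 t v)"
      and h = "\<lambda>v. exp_L1 (t * x\<^sup>2) (pow_L0 x (-2) v)"])
  show "Vector_Spaces.linear scale scale (\<lambda>v. pow_L0 x (-2) (exp_L1 t v))"
    using Vector_Spaces.linear_compose[OF linear_exp_L1 linear_pow_L0] by (simp add: o_def)
  show "Vector_Spaces.linear scale scale (\<lambda>v. exp_L1 (t * x\<^sup>2) (pow_L0 x (-2) v))"
    using Vector_Spaces.linear_compose[OF linear_pow_L0 linear_exp_L1] by (simp add: o_def)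
  fix n v assume v: "v \<in> V n"
  obtain p where p: "(L 1 ^^ p) v = 0" using L1_locally_nilpotent by blast
  have "x powi (- 2 * (n - int k)) = x powi (- 2 * n) * (x\<^sup>2) ^ k" for k
  proof -
    have "x powi (- 2 * n + int (2 * k)) = x powi (- 2 * n) * x powi int (2 * k)"
      using assms by (intro power_int_add) simp
    moreover have "- 2 * n + int (2 * k) = - 2 * (n - int k)" by simp
    ultimately show ?thesis
      by (simp only: power_int_of_nat power_mult)
  qed
  then have pow: "pow_L0 x (-2) ((L 1 ^^ k) v)
      = scale (x powi (- 2 * n) * (x\<^sup>2) ^ k) ((L 1 ^^ k) v)" for k
    using pow_L0_homogeneous[OF L1_power_degree[OF v, of k], of x "-2"] by simp
  have "pow_L0 x (-2) (exp_L1 t v)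
      = (\<Sum>k<p. scale (t ^ k / fact k * (x powi (- 2 * n) * (x\<^sup>2) ^ k)) ((L 1 ^^ k) v))"
    by (simp add: exp_L1_eq_sum[OF p] vs.linear_sum[OF linear_pow_L0]
        vs.linear_scale[OF linear_pow_L0] pow)
  also have "\<dots> = scale (x powi (- 2 * n)) (exp_L1 (t * x\<^sup>2) v)"
    by (simp add: exp_L1_eq_sum[OF p] scale_sum_right power_mult_distrib mult_ac)
  also have "\<dots> = exp_L1 (t * x\<^sup>2) (pow_L0 x (-2) v)"
    by (simp add: pow_L0_homogeneous[OF v] vs.linear_scale[OF linear_exp_L1])
  finally show "pow_L0 x (-2) (exp_L1 t v) = exp_L1 (t * x\<^sup>2) (pow_L0 x (-2) v)" .
qed

lemma linear_K: "Vector_Spaces.linear scale scale (K g \<tau>)"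
  unfolding K_def by (rule Vector_Spaces.linear_compose[OF linear_pow_L0 linear_exp_L1])

text \<open>Once both exponentials are moved to the left of \<open>w^(-2 L 0)\<close>, they combine to \<open>e^(-t L 1)\<close> if
  \<open>t (1 - w^2) = c w\<close>, where \<open>w = j g \<tau>\<close> and \<open>c = g$2$1\<close>.  On the unit circle
  \<open>1 - w^2 = - w (w - cnj w)\<close>, and \<open>w - cnj w = 2 \<i> c Im \<tau>\<close>, which gives a value of \<open>t\<close>
  that depends on \<open>\<tau>\<close> only and covers the case \<open>w^2 = 1\<close>.\<close>

lemma K_conjugate:
  assumes "fixes_point g \<tau>" "\<tau> \<in> upper_half_plane" "det g = 1"
  defines "t \<equiv> \<i> / (2 * of_real (Im \<tau>))"
  shows "K g \<tau> (exp_L1 (- t) v) = exp_L1 (- t) (pow_L0 (j g \<tau>) (-2) v)"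
proof -
  define w where "w = j g \<tau>"
  have y: "Im \<tau> > 0" using assms(2) by (simp add: upper_half_plane_def)
  have norm: "cmod w = 1" using norm_j_eq_1 assms(1-3) by (simp add: w_def)
  then have "w \<noteq> 0" by auto
  have unimodular: "w * cnj w = 1"
    using norm by (simp flip: complex_norm_square)
  have "w - cnj w = 2 * \<i> * of_real (g$2$1 * Im \<tau>)"
    by (simp add: w_def j_def complex_eq_iff)
  then have "t * (w - cnj w) = t * (2 * \<i> * of_real (g$2$1 * Im \<tau>))" by simp
  also have "\<dots> = - of_real (g$2$1)"
    using y by (simp add: t_def field_simps)
  finally have "t * (w - cnj w) = - of_real (g$2$1)" .
  then have "t * (w - cnj w) * w = - of_real (g$2$1) * w" by simp
  then have "t * w\<^sup>2 - t = - (of_real (g$2$1) * w)"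
    using unimodular by (simp add: power2_eq_square algebra_simps)
  then have param: "- (of_real (g$2$1) * w) + (- t) * w\<^sup>2 = - t"
    by (simp flip: \<open>t * w\<^sup>2 - t = - (of_real (g$2$1) * w)\<close>)
  show ?thesis
    unfolding K_def o_apply w_def[symmetric]
    unfolding pow_L0_exp_L1[OF \<open>w \<noteq> 0\<close>] exp_L1_add param ..
qed

subsection \<open>Finite order and diagonalizability\<close>

lemma homogeneous_subset_F: "n \<le> N \<Longrightarrow> V n \<subseteq> F N"
  unfolding F_def by (intro subsetI span_base) auto

lemma F_invariantI:
  assumes f: "Vector_Spaces.linear scale scale f"
    and mem: "\<And>n v. n \<le> N \<Longrightarrow> v \<in> V n \<Longrightarrow> f v \<in> F N"
  shows "f ` F N \<subseteq> F N"
proof -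
  have "f ` (\<Union>n\<in>{..N}. V n) \<subseteq> F N"
    using mem by blast
  then have "span (f ` (\<Union>n\<in>{..N}. V n)) \<subseteq> F N"
    unfolding F_def by (intro span_minimal subspace_span)
  then show ?thesis
    unfolding F_def vs.linear_span_image[OF f] .
qed

lemma exp_L1_F: "exp_L1 x ` F N \<subseteq> F N"
proof (rule F_invariantI[OF linear_exp_L1])
  fix n v assume n: "n \<le> N" "v \<in> V n"
  obtain p where p: "(L 1 ^^ p) v = 0" using L1_locally_nilpotent by blast
  have "(L 1 ^^ k) v \<in> F N" for k
    using n(1) by (intro subsetD[OF homogeneous_subset_F L1_power_degree[OF n(2), of k]]) simp
  then show "exp_L1 x v \<in> F N"
    unfolding exp_L1_eq_sum[OF p] F_def by (intro span_sum span_scale)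
qed

lemma pow_L0_F: "pow_L0 x s ` F N \<subseteq> F N"
proof (rule F_invariantI[OF linear_pow_L0])
  fix n v assume "n \<le> N" "v \<in> V n"
  then have "v \<in> F N"
    using homogeneous_subset_F by blast
  then show "pow_L0 x s v \<in> F N"
    unfolding pow_L0_homogeneous[OF \<open>v \<in> V n\<close>] F_def by (rule span_scale)
qed

lemma operator_on_scaled_K: "operator_on scale (F N) (\<lambda>v. scale c (K g \<tau> v))"
  unfolding operator_on_def
proof
  show "Vector_Spaces.linear scale scale (\<lambda>v. scale c (K g \<tau> v))"
    by (intro vs.linear_compose_scale_right linear_K)
  have "K g \<tau> v \<in> F N" if "v \<in> F N" for v
    using exp_L1_F pow_L0_F that unfolding K_def by fastforce
  then show "(\<lambda>v. scale c (K g \<tau> v)) ` F N \<subseteq> F N"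
    by (auto simp: F_def intro: span_scale)
qed

lemma exp_L1_inverse: "exp_L1 t (exp_L1 (- t) v) = v" "exp_L1 (- t) (exp_L1 t v) = v"
  by (simp_all add: exp_L1_add exp_L1_0)

text \<open>\<open>F N\<close> is spanned by homogeneous vectors, so some of them form a basis; \<open>e^(-t L 1)\<close> is an
  automorphism of \<open>F N\<close> and takes them to eigenvectors.\<close>

lemma diagonalizable_scaled_K:
  assumes "fixes_point g \<tau>" "\<tau> \<in> upper_half_plane" "det g = 1"
  shows "diagonalizable_on scale (F N) (\<lambda>v. scale c (K g \<tau> v))"
proof -
  define t where "t = \<i> / (2 * of_real (Im \<tau>))"
  note conj = K_conjugate[OF assms, folded t_def]
  obtain B where B: "B \<subseteq> (\<Union>n\<in>{..N}. V n)" "independent B" "(\<Union>n\<in>{..N}. V n) \<subseteq> span B"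
    using maximal_independent_subset by blast
  have spanB: "span B = F N"
    unfolding F_def using B by (simp add: span_minimal span_mono subset_antisym)
  have "inj (exp_L1 (- t))"
    by (rule injI) (metis exp_L1_inverse(1))
  then have "independent (exp_L1 (- t) ` B)"
    using B(2) by (intro vs.linear_independent_injective_image[OF linear_exp_L1])
      (auto intro: inj_on_subset)
  moreover have "span (exp_L1 (- t) ` B) = F N"
  proof -
    have "F N \<subseteq> exp_L1 (- t) ` F N"
    proof
      fix v assume "v \<in> F N"
      then have "exp_L1 t v \<in> F N" using exp_L1_F by blast
      then show "v \<in> exp_L1 (- t) ` F N" by (metis exp_L1_inverse(2) imageI)
    qed
    then show ?thesis
      using exp_L1_F by (simp add: vs.linear_span_image[OF linear_exp_L1] spanB subset_antisym)
  qed
  moreover have "\<exists>e. scale c (K g \<tau> b) = scale e b" if "b \<in> exp_L1 (- t) ` B" for b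
  proof -
    obtain u n where u: "u \<in> V n" "b = exp_L1 (- t) u"
      using \<open>b \<in> exp_L1 (- t) ` B\<close> B(1) by blast
    then have "scale c (K g \<tau> b) = scale (c * j g \<tau> powi (- 2 * n)) b"
      by (simp add: conj pow_L0_homogeneous[OF u(1)] vs.linear_scale[OF linear_exp_L1])
    then show ?thesis ..
  qed
  ultimately show ?thesis
    using operator_on_scaled_K unfolding diagonalizable_on_def by blast
qed

lemma pow_L0_funpow:
  assumes "(x ^ m)\<^sup>2 = 1"
  shows "(pow_L0 x (-2) ^^ m) v = v"
proof (rule linear_eq_if_eq_homogeneous[where f = "pow_L0 x (-2) ^^ m" and h = "\<lambda>v. v"])
  show "Vector_Spaces.linear scale scale (pow_L0 x (-2) ^^ m)"
    by (rule linear_funpow[OF linear_pow_L0])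
  show "Vector_Spaces.linear scale scale (\<lambda>v. v)" by (rule linearI) simp_all
  fix n v assume v: "v \<in> V n"
  have "(pow_L0 x (-2) ^^ k) v = scale ((x powi (- 2 * n)) ^ k) v" for k
    by (induction k)
       (simp_all add: pow_L0_homogeneous[OF v] vs.linear_scale[OF linear_pow_L0] mult.commute)
  moreover have "(x powi (- 2 * n)) ^ m = 1"
  proof -
    have "(x powi (- 2 * n)) ^ m = (x ^ m) powi (2 * (- n))"
      by (simp add: power_int_power_commute)
    also have "\<dots> = ((x ^ m)\<^sup>2) powi (- n)"
      by (simp only: power_int_mult power_int_numeral)
    finally show ?thesis using assms by simp
  qed
  ultimately show "(pow_L0 x (-2) ^^ m) v = v" by simp
qed

lemma K_funpow:
  assumes "fixes_point g \<tau>" "\<tau> \<in> upper_half_plane" "det g = 1" "(j g \<tau> ^ m)\<^sup>2 = 1"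
  shows "(K g \<tau> ^^ m) v = v"
proof -
  define t where "t = \<i> / (2 * of_real (Im \<tau>))"
  have "(K g \<tau> ^^ k) (exp_L1 (- t) u) = exp_L1 (- t) ((pow_L0 (j g \<tau>) (-2) ^^ k) u)" for k u
    by (induction k) (simp_all add: K_conjugate[OF assms(1-3), folded t_def])
  from this[of m "exp_L1 t v"] show ?thesis
    by (simp add: pow_L0_funpow[OF assms(4)] exp_L1_inverse)
qed

lemma scaled_K_funpow: "((\<lambda>v. scale c (K g \<tau> v)) ^^ n) v = scale (c ^ n) ((K g \<tau> ^^ n) v)"
  by (induction n) (simp_all add: vs.linear_scale[OF linear_K] mult.commute)

text \<open>The exponent is \<open>2m\<close> rather than \<open>m\<close>: if the lift has \<open>w^m = -1\<close> and \<open>k\<close> is odd, the \<open>m\<close>-th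
  power is \<open>-1\<close>.\<close>

lemma finite_order_scaled_K:
  assumes "fixes_point g \<tau>" "\<tau> \<in> upper_half_plane" "det g = 1"
    and m: "m > 0" "(j g \<tau> ^ m)\<^sup>2 = 1"
  shows "finite_order_on scale (F N) (\<lambda>v. scale (j g \<tau> powi k) (K g \<tau> v))"
proof -
  have scalar: "(j g \<tau> powi k) ^ (m * 2) = 1"
    using m(2) by (simp add: power_int_power_commute power_mult)
  have "(K g \<tau> ^^ (m * 2)) v = v" for v
    by (simp add: K_funpow[OF assms(1-3) m(2)] funpow_add mult_2_right)
  then have "((\<lambda>v. scale (j g \<tau> powi k) (K g \<tau> v)) ^^ (m * 2)) v = v" for v
    unfolding scaled_K_funpow scalar by simp
  then show ?thesis
    using operator_on_scaled_K m(1) unfolding finite_order_on_def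
    by (intro conjI exI[of _ "m * 2"]) auto
qed

end

theorem lemma3p4:
  fixes scale :: "complex \<Rightarrow> 'v::ab_group_add \<Rightarrow> 'v"
    and Y :: "'v \<Rightarrow> int \<Rightarrow> 'v \<Rightarrow> 'v" and vac :: 'v
    and V :: "int \<Rightarrow> 'v set" and L :: "int \<Rightarrow> 'v \<Rightarrow> 'v"
    and \<Gamma> :: "(real^2^2) set set" and \<tau> :: complex
    and \<gamma> :: "(real^2^2) set" and g :: "real^2^2" and m :: nat
  assumes "quasi_voa scale Y vac V L"
    and "fuchsian_first_kind \<Gamma>"
    and "elliptic_point \<Gamma> \<tau>"
    and "\<gamma> \<in> \<Gamma>" and "generate PSL2R {\<gamma>} = stab \<Gamma> \<tau>"
    and "m = card (stab \<Gamma> \<tau>)"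
    and "g \<in> \<gamma>"
  shows "(\<forall>N. \<forall>v\<in>graded_vertex_algebra.F scale V N.
             (quasi_voa.K scale V L g \<tau> ^^ m) v = v)
       \<and> (\<forall>N. \<forall>k::int.
             finite_order_on scale (graded_vertex_algebra.F scale V N)
               (\<lambda>v. scale (j g \<tau> powi k) (quasi_voa.K scale V L g \<tau> v))
           \<and> diagonalizable_on scale (graded_vertex_algebra.F scale V N)
               (\<lambda>v. scale (j g \<tau> powi k) (quasi_voa.K scale V L g \<tau> v)))"
proof -
  interpret Q: quasi_voa scale Y vac V L by (rule assms(1))
  have fuchs: "fuchsian_group \<Gamma>"
    using assms(2) by (simp add: fuchsian_first_kind_def)
  have \<tau>: "\<tau> \<in> upper_half_plane"
    using assms(3) by (simp add: elliptic_point_def)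
  have \<gamma>P: "\<gamma> \<in> carrier PSL2R"
    using fuchs assms(4) by (auto simp: fuchsian_group_def dest: subgroup.mem_carrier)
  have "\<gamma> \<in> stab \<Gamma> \<tau>"
    using assms(5) generate.incl[of \<gamma> "{\<gamma>}" PSL2R] by simp
  then have "moebius g \<tau> = \<tau>"
    using psl_act_eq[OF \<gamma>P assms(7)] by (simp add: stab_def stabilizer_def)
  then have fp: "fixes_point g \<tau>"
    using \<tau> by (rule fixes_point_if_moebius)
  have det: "det g = 1"
    using PSL2R_eq_coset(1)[OF \<gamma>P assms(7)] by simp
  have "m = card (generate PSL2R {\<gamma>})"
    using assms(5,6) by simp
  note order = elliptic_order[OF fuchs assms(4,7) fp \<tau> this]
  show ?thesis
    using Q.K_funpow[OF fp \<tau> det order(2)] Q.finite_order_scaled_K[OF fp \<tau> det order]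
      Q.diagonalizable_scaled_K[OF fp \<tau> det] by blast
qed

end
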